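(* Let $N\ge1$ be an integer and consider the trigonometric grid $$x_s=-\cos\left(\frac{\pi(s+1)}{N+2}\right),\qquad s=0,1,\dots,N,$$ which consists of the zeros of the Chebyshev polynomial of the second kind $U_{N+1}$. Then the Sturmian sequence on this grid is $$P_{N+1}(x)=U_{N+1}(x),\qquad P_n(x)=C_n^{(2)}(x),\quad n=0,1,\dots,N,$$ where $U_{N+1}$ is monic and $C_n^{(2)}$ are the monic ultraspherical polynomials with $\lambda=2$. These polynomials satisfy the recurrence relation $$P_{n+1}(x)+u_nP_{n-1}(x)=xP_n(x),\qquad n=1,2,\dots,N,$$ with $$u_n=\frac{n(n+3)}{4(n+2)(n+1)},\quad n=1,2,\dots,N-1,\qquad u_N=\frac{N}{2(N+1)}.$$
   Context: Sturmian sequence on a grid: given distinct real numbers $x_0,\dots,x_N$, put $P_{N+1}(x)=\prod_{s=0}^N(x-x_s)$ and $P_N(x)=(N+1)^{-1}P_{N+1}'(x)$. The Euclidean algorithm produces uniquely monic polynomials $P_{N-1},\dots,P_0=1$ ($\deg P_n=n$), real $b_n$ and $u_n>0$ with $P_{n+1}(x)=(x-b_n)P_n(x)-u_nP_{n-1}(x)$ for $n=1,\dots,N$, and $P_1(x)=x-b_0$. Monic Chebyshev polynomials of the second kind: $U_n(x)=2^{-n}\dfrac{\sin((n+1)\theta)}{\sin\theta}$ with $x=\cos\theta$. Monic ultraspherical polynomials: $$C_n^{(\lambda)}(x)=\kappa_n\;{}_2F_1\left({-n,\ n+2\lambda\atop \lambda+1/2};\frac{1-x}{2}\right),\qquad \kappa_n=2^{-n}\frac{(2\lambda)_n}{(\lambda)_n},\qquad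 (y)_n=y(y+1)\cdots(y+n-1).$$ *)

theory Defs
  imports Complex_Main "HOL-Computational_Algebra.Computational_Algebra"
begin

definition sturmian_sequence ::
  "nat \<Rightarrow> (nat \<Rightarrow> real) \<Rightarrow> (nat \<Rightarrow> real poly) \<Rightarrow> (nat \<Rightarrow> real) \<Rightarrow> (nat \<Rightarrow> real) \<Rightarrow> bool"
where
  "sturmian_sequence N x P b u \<longleftrightarrow>
     inj_on x {0..N} \<and>
     P (N + 1) = (\<Prod>s\<in>{0..N}. [:- x s, 1:]) \<and>
     P N = smult (1 / (real N + 1)) (pderiv (P (N + 1))) \<and>
     (\<forall>n\<in>{0..N + 1}. degree (P n) = n \<and> lead_coeff (P n) = 1) \<and>
     P 1 = [:- b 0, 1:] \<and>
     (\<forall>n\<in>{1..N}. u n > 0 \<and> P (n + 1) = [:- b n, 1:] * P n - smult (u n) (P (n - 1)))"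

text \<open>
  The trigonometric formula determines the polynomial only away from the zeros of
  \<open>sin\<close>; existence and uniqueness are \<open>ex1_chebyshev_U_monic\<close> below.
\<close>

definition chebyshev_U_monic :: "nat \<Rightarrow> real poly" where
  "chebyshev_U_monic n =
     (THE p. \<forall>\<theta>. sin \<theta> \<noteq> 0 \<longrightarrow>
        poly p (cos \<theta>) = sin ((real n + 1) * \<theta>) / (2 ^ n * sin \<theta>))"

lemma ex_chebyshev_U_monic:
  "\<exists>p :: real poly. \<forall>\<theta>. sin \<theta> \<noteq> 0 \<longrightarrow>
     poly p (cos \<theta>) = sin ((real n + 1) * \<theta>) / (2 ^ n * sin \<theta>)"
proof (induction n rule: induct_nat_012)
  case 0
  show ?case by (rule exI[of _ 1]) simp
next
  case 1
  have "poly [:0, 1:] (cos \<theta>) = sin ((real (Suc 0) + 1) * \<theta>) / (2 ^ Suc 0 * sin \<theta>)"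
    if "sin \<theta> \<noteq> 0" for \<theta> :: real
    using that by (simp add: sin_double)
  then show ?case by blast
next
  case (ge2 n)
  from ge2 obtain p q :: "real poly" where
    p: "\<And>\<theta>. sin \<theta> \<noteq> 0 \<Longrightarrow> poly p (cos \<theta>) = sin ((real n + 1) * \<theta>) / (2 ^ n * sin \<theta>)" and
    q: "\<And>\<theta>. sin \<theta> \<noteq> 0 \<Longrightarrow>
      poly q (cos \<theta>) = sin ((real (Suc n) + 1) * \<theta>) / (2 ^ Suc n * sin \<theta>)"
    by blast
  have "poly ([:0, 1:] * q - smult (1/4) p) (cos \<theta>)
      = sin ((real (Suc (Suc n)) + 1) * \<theta>) / (2 ^ Suc (Suc n) * sin \<theta>)"
    if nz: "sin \<theta> \<noteq> 0" for \<theta> :: real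
  proof -
    define a where "a = (real (Suc n) + 1) * \<theta>"
    have e: "(real (Suc (Suc n)) + 1) * \<theta> = a + \<theta>" "(real n + 1) * \<theta> = a - \<theta>"
      by (simp_all add: a_def algebra_simps)
    have "sin (a + \<theta>) = 2 * cos \<theta> * sin a - sin (a - \<theta>)"
      by (simp add: sin_add sin_diff)
    moreover have "poly p (cos \<theta>) = sin (a - \<theta>) / (2 ^ n * sin \<theta>)"
      using p[OF nz] unfolding e .
    moreover have "poly q (cos \<theta>) = sin a / (2 ^ Suc n * sin \<theta>)"
      using q[OF nz] unfolding a_def .
    ultimately show ?thesis
      unfolding e using nz by (simp add: field_simps)
  qed
  then show ?case by blast
qed

lemma ex1_chebyshev_U_monic:
  "\<exists>!p :: real poly. \<forall>\<theta>. sin \<theta> \<noteq> 0 \<longrightarrow>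
     poly p (cos \<theta>) = sin ((real n + 1) * \<theta>) / (2 ^ n * sin \<theta>)"
proof (rule ex_ex1I[OF ex_chebyshev_U_monic])
  fix p q :: "real poly"
  assume p: "\<forall>\<theta>. sin \<theta> \<noteq> 0 \<longrightarrow>
      poly p (cos \<theta>) = sin ((real n + 1) * \<theta>) / (2 ^ n * sin \<theta>)"
    and q: "\<forall>\<theta>. sin \<theta> \<noteq> 0 \<longrightarrow>
      poly q (cos \<theta>) = sin ((real n + 1) * \<theta>) / (2 ^ n * sin \<theta>)"
  have "{-1<..<1} \<subseteq> {x. poly (p - q) x = 0}"
  proof
    fix x :: real assume x: "x \<in> {-1<..<1}"
    then have "cos (arccos x) = x" "sin (arccos x) \<noteq> 0"
      using sin_arccos_nonzero[of x] by auto
    then have "poly p x = poly q x" using p q by metis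
    then show "x \<in> {x. poly (p - q) x = 0}" by simp
  qed
  moreover have "infinite {-1<..<1::real}" by (simp add: infinite_Ioo)
  ultimately have "infinite {x. poly (p - q) x = 0}" using finite_subset by blast
  then have "p - q = 0" using poly_roots_finite by blast
  then show "p = q" by simp
qed

lemma poly_chebyshev_U_monic:
  assumes "sin \<theta> \<noteq> 0"
  shows "poly (chebyshev_U_monic n) (cos \<theta>) = sin ((real n + 1) * \<theta>) / (2 ^ n * sin \<theta>)"
  using theI'[OF ex1_chebyshev_U_monic[of n]] assms unfolding chebyshev_U_monic_def by blast

text \<open>
  The series \<open>2F1(-n, n + 2 l; l + 1/2; z)\<close> terminates at the power \<open>z ^ n\<close>
  (\<open>fps_hypergeo_terminating\<close>), so the sum below is its value at the polynomial
  \<open>z = (1 - x) / 2\<close>. The parameter must not make a denominator vanish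
  (\<open>l > -1/2\<close> and \<open>l \<noteq> 0\<close> is enough).
\<close>

lemma fps_hypergeo_terminating:
  fixes a c :: real
  assumes "k > n"
  shows "fps_nth (fps_hypergeo [- real n, a] [c] 1) k = 0"
  using assms by (simp add: pochhammer_of_nat_eq_0_iff)

definition ultraspherical_monic :: "real \<Rightarrow> nat \<Rightarrow> real poly" where
  "ultraspherical_monic l n =
     smult (pochhammer (2 * l) n / (2 ^ n * pochhammer l n))
       (\<Sum>k\<le>n. smult (fps_nth (fps_hypergeo [- real n, real n + 2 * l] [l + 1/2] 1) k)
                     ([:1/2, -1/2:] ^ k))"

definition trig_grid :: "nat \<Rightarrow> nat \<Rightarrow> real" where
  "trig_grid N s = - cos (pi * (real s + 1) / (real N + 2))"

end

theory Submission
  imports Defs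
begin

text \<open>
  Two classical facts about the monic ultraspherical polynomials \<open>C\<^sub>n\<^sup>l\<close>, both read off
  from the coefficients of the terminating hypergeometric series in \<open>z = (1 - x) / 2\<close>, carry the
  proof: the three-term recurrence (\<open>ultraspherical_monic_rec\<close>) and the rule that differentiation
  raises the parameter, \<open>(C\<^sub>n\<^sub>+\<^sub>1\<^sup>l)' = (n + 1) C\<^sub>n\<^sup>l\<^sup>+\<^sup>1\<close> (\<open>pderiv_ultraspherical_monic\<close>).
  For \<open>l = 1\<close> the recurrence is the addition formula for the sine, so \<open>C\<^sub>n\<^sup>1 = U\<^sub>n\<close>; the rule for
  the derivative then says \<open>U\<^sub>N\<^sub>+\<^sub>1' = (N + 1) C\<^sub>N\<^sup>2\<close>, which is how the Sturmian sequence starts.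

  For \<open>l = 2\<close> the recurrence is the one claimed for \<open>n < N\<close>. The top step \<open>n = N\<close> is different,
  since \<open>P\<^sub>N\<^sub>+\<^sub>1\<close> is a Chebyshev polynomial and not \<open>C\<^sub>N\<^sub>+\<^sub>1\<^sup>2\<close>. It comes from differentiating
  \<open>U\<^sub>n\<^sub>+\<^sub>3 = x U\<^sub>n\<^sub>+\<^sub>2 - U\<^sub>n\<^sub>+\<^sub>1 / 4\<close>: every derivative becomes some \<open>C\<^sup>2\<close>, the product rule leaves
  one undifferentiated \<open>U\<^sub>n\<^sub>+\<^sub>2\<close>, and solving for it expresses \<open>U\<^sub>n\<^sub>+\<^sub>2\<close> by \<open>C\<^sup>2\<close>
  (\<open>chebyshev_U_monic_connection\<close>).

  Uniqueness belongs to the Euclidean algorithm on any grid (\<open>sturmian_sequence_unique\<close>): the grid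
  fixes the two top polynomials, and degrees and leading coefficients then force \<open>b\<^sub>n\<close>, \<open>u\<^sub>n\<close> and
  \<open>P\<^sub>n\<^sub>-\<^sub>1\<close> at each step downwards.
\<close>

section \<open>Ultraspherical polynomials as hypergeometric sums\<close>

definition ultraspherical_coeff :: "real \<Rightarrow> nat \<Rightarrow> nat \<Rightarrow> real" where
  "ultraspherical_coeff l n k =
     pochhammer (2 * l) n / (2 ^ n * pochhammer l n) *
     (pochhammer (- real n) k * pochhammer (real n + 2 * l) k / (pochhammer (l + 1/2) k * fact k))"

lemma smult_sum2: "smult m (\<Sum>i\<in>S. f i) = (\<Sum>i\<in>S. smult m (f i :: 'a :: comm_ring poly))"
  by (induction S rule: infinite_finite_induct) (auto simp: smult_add_right)

text \<open>
  The terms beyond \<open>n\<close> vanish, so the polynomials in a recurrence can all be summed over one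
  common range and compared term by term.
\<close>
lemma ultraspherical_monic_altdef:
  assumes "n \<le> m"
  shows "ultraspherical_monic l n = (\<Sum>k\<le>m. smult (ultraspherical_coeff l n k) ([:1/2, -1/2:] ^ k))"
proof -
  have "ultraspherical_monic l n = (\<Sum>k\<le>n. smult (ultraspherical_coeff l n k) ([:1/2, -1/2:] ^ k))"
    by (simp add: ultraspherical_monic_def ultraspherical_coeff_def smult_sum2)
  also have "\<dots> = (\<Sum>k\<le>m. smult (ultraspherical_coeff l n k) ([:1/2, -1/2:] ^ k))"
    using assms by (intro sum.mono_neutral_left)
      (auto simp: ultraspherical_coeff_def pochhammer_of_nat_eq_0_iff)
  finally show ?thesis .
qed

lemma ultraspherical_coeff_0_rec:
  assumes "l > 0"
  shows "ultraspherical_coeff l (n + 2) 0 = ultraspherical_coeff l (n + 1) 0 -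
    real (n + 1) * (real n + 2 * l) / (4 * (real n + 1 + l) * (real n + l)) * ultraspherical_coeff l n 0"
proof -
  have "pochhammer l n > 0" "real n + l > 0" using assms by (auto intro: pochhammer_pos)
  with assms show ?thesis
    by (simp add: ultraspherical_coeff_def pochhammer_Suc divide_simps add_eq_0_iff)
       (simp add: algebra_simps)
qed

text \<open>
  With \<open>x = 1 - 2 z\<close>, this is the coefficient of \<open>z ^ Suc j\<close> in the three-term recurrence. All four
  coefficients are rational multiples of one product of Pochhammer symbols (\<open>R\<close> in the proof),
  because neighbouring Pochhammer symbols differ by one linear factor; dividing by \<open>R\<close> leaves a
  polynomial identity.
\<close>
lemma ultraspherical_coeff_Suc_rec:
  assumes "l > 0"
  shows "ultraspherical_coeff l (n + 2) (Suc j) = ultraspherical_coeff l (n + 1) (Suc j)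
    - 2 * ultraspherical_coeff l (n + 1) j
    - real (n + 1) * (real n + 2 * l) / (4 * (real n + 1 + l) * (real n + l)) * ultraspherical_coeff l n (Suc j)"
proof -
  define K where "K = pochhammer (2 * l) n / (2 ^ n * pochhammer l n)"
  define A where "A = pochhammer (- real (n + 1)) j"
  define B where "B = pochhammer (real (n + 1) + 2 * l) j"
  define G where "G = pochhammer (l + 1/2) j"
  define F :: real where "F = fact j"
  \<comment> \<open>The linear factors are kept as opaque atoms, so that simplification cancels them as a whole.\<close>
  define p where "p = real n + l"
  define p1 where "p1 = real n + 1 + l"
  define q where "q = l + 1/2 + real j"
  define w where "w = real n + 2 * l"
  define w1 where "w1 = real n + 1 + 2 * l"
  define b where "b = real n + 1 + 2 * l + real j"
  define x1 where "x1 = real n + 1"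
  define y1 where "y1 = real j + 1"
  define d where "d = real j - real n - 1"
  define R where "R = K * A * B * w / (4 * p * p1 * G * q * F * y1)"
  have "pochhammer l n > 0" "G > 0" "F > 0" "p > 0" "p1 > 0" "q > 0" "w1 > 0" "x1 > 0" "y1 > 0"
    using assms by (auto intro: pochhammer_pos
        simp: G_def F_def p_def p1_def q_def w1_def x1_def y1_def)
  then have nz: "pochhammer l n \<noteq> 0" "G \<noteq> 0" "F \<noteq> 0" "p \<noteq> 0" "p1 \<noteq> 0" "q \<noteq> 0" "w1 \<noteq> 0" "x1 \<noteq> 0" "y1 \<noteq> 0"
    by simp_all
  have K1: "pochhammer (2 * l) (n + 1) / (2 ^ (n + 1) * pochhammer l (n + 1)) = K * w / (2 * p)"
    by (simp add: K_def w_def p_def pochhammer_Suc add_ac)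
  have K2: "pochhammer (2 * l) (n + 2) / (2 ^ (n + 2) * pochhammer l (n + 2)) =
      K * w * w1 / (4 * p * p1)"
  proof -
    have "pochhammer (2 * l) (n + 2) = pochhammer (2 * l) n * w * w1"
      "pochhammer l (n + 2) = pochhammer l n * p * p1"
      by (simp_all add: w_def w1_def p_def p1_def pochhammer_Suc add_ac)
    then show ?thesis by (simp add: K_def)
  qed
  have A1: "pochhammer (- real (n + 1)) (Suc j) = A * d"
    by (simp add: A_def d_def pochhammer_Suc algebra_simps)
  have A2: "pochhammer (- real (n + 2)) (Suc j) = - ((x1 + 1) * A)"
    using pochhammer_rec[of "- real (n + 2)" j] by (simp add: A_def x1_def algebra_simps)
  have A0: "pochhammer (- real n) (Suc j) = - (A * d * (d + 1) / x1)"
  proof -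
    have "A * d = - x1 * pochhammer (- real n) j"
      using pochhammer_rec[of "- real (n + 1)" j] unfolding A1 by (simp add: x1_def)
    then have "pochhammer (- real n) j = - (A * d / x1)"
      using nz by (simp add: field_simps)
    then show ?thesis by (simp add: pochhammer_Suc d_def)
  qed
  have B0: "pochhammer (real n + 2 * l) (Suc j) = w * B"
    using pochhammer_rec[of "real n + 2 * l" j] by (simp add: B_def w_def algebra_simps)
  have B1: "pochhammer (real (n + 1) + 2 * l) (Suc j) = B * b"
    by (simp add: B_def b_def pochhammer_Suc algebra_simps)
  have B2: "pochhammer (real (n + 2) + 2 * l) (Suc j) = B * b * (b + 1) / w1"
  proof -
    have "B * b = w1 * pochhammer (real (n + 2) + 2 * l) j"
      using pochhammer_rec[of "real (n + 1) + 2 * l" j] unfolding B1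
      by (simp add: w1_def algebra_simps)
    then have "pochhammer (real (n + 2) + 2 * l) j = B * b / w1"
      using nz by (simp add: field_simps)
    then show ?thesis by (simp add: pochhammer_Suc b_def add_ac)
  qed
  have GF: "pochhammer (l + 1/2) (Suc j) * fact (Suc j) = G * q * (F * y1)"
    by (simp add: G_def F_def q_def y1_def pochhammer_Suc algebra_simps)
  have u: "real (n + 1) * (real n + 2 * l) / (4 * (real n + 1 + l) * (real n + l)) =
      x1 * w / (4 * p1 * p)"
    by (simp add: x1_def w_def p1_def p_def add_ac)
  have C0: "x1 * w / (4 * p1 * p) * ultraspherical_coeff l n (Suc j) = - (R * (w * d * (d + 1)))"
    unfolding ultraspherical_coeff_def A0 B0 GF K_def[symmetric] R_def using nz by (simp add: mult_ac)
  have C1: "ultraspherical_coeff l (n + 1) (Suc j) = R * (2 * p1 * d * b)"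
    unfolding ultraspherical_coeff_def A1 B1 GF K1 R_def using nz by (simp add: mult_ac)
  have C1': "2 * ultraspherical_coeff l (n + 1) j = R * (4 * p1 * q * y1)"
    unfolding ultraspherical_coeff_def K1 A_def[symmetric] B_def[symmetric] G_def[symmetric]
      F_def[symmetric] R_def using nz by (simp add: mult_ac)
  have C2: "ultraspherical_coeff l (n + 2) (Suc j) = R * - ((x1 + 1) * b * (b + 1))"
    unfolding ultraspherical_coeff_def A2 B2 GF K2 R_def using nz by (simp add: mult_ac)
  have "- ((x1 + 1) * b * (b + 1)) = 2 * p1 * d * b - 4 * p1 * q * y1 + w * d * (d + 1)"
    unfolding x1_def b_def p1_def d_def q_def y1_def w_def by (simp add: algebra_simps)
  then show ?thesis
    unfolding u C0 C1 C1' C2 by (simp only: distrib_left right_diff_distrib diff_minus_eq_add)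
qed

lemma ultraspherical_monic_rec:
  assumes "l > 0"
  shows "ultraspherical_monic l (n + 2) = [:0, 1:] * ultraspherical_monic l (n + 1) -
    smult (real (n + 1) * (real n + 2 * l) / (4 * (real n + 1 + l) * (real n + l)))
      (ultraspherical_monic l n)"
proof -
  define z :: "real poly" where "z = [:1/2, -1/2:]"
  define u where "u = real (n + 1) * (real n + 2 * l) / (4 * (real n + 1 + l) * (real n + l))"
  let ?c = "ultraspherical_coeff l"
  let ?S = "\<lambda>m. \<Sum>j\<le>n+1. smult (?c m (Suc j)) (z ^ Suc j)"
  have exp: "ultraspherical_monic l m = smult (?c m 0) 1 + ?S m" if "m \<le> n + 2" for m
    using ultraspherical_monic_altdef[of m "Suc (n + 1)" l] that
    unfolding sum.atMost_Suc_shift by (simp add: z_def)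
  have "smult (- 2) z * ultraspherical_monic l (n + 1) =
      (\<Sum>j\<le>n+1. smult (- 2 * ?c (n + 1) j) (z ^ Suc j))"
    unfolding ultraspherical_monic_altdef[OF order_refl] z_def[symmetric] sum_distrib_left
    by (intro sum.cong refl) (simp add: mult.commute)
  moreover have "[:0, 1:] = 1 + smult (- 2) z" by (simp add: z_def one_pCons)
  ultimately have "[:0, 1:] * ultraspherical_monic l (n + 1) =
      ultraspherical_monic l (n + 1) + (\<Sum>j\<le>n+1. smult (- 2 * ?c (n + 1) j) (z ^ Suc j))"
    by (simp only: distrib_right mult_1_left)
  moreover have "?S (n + 2) = ?S (n + 1) + (\<Sum>j\<le>n+1. smult (- 2 * ?c (n + 1) j) (z ^ Suc j))
       - smult u (?S n)"
    unfolding smult_sum2 sum.distrib[symmetric] sum_subtractf[symmetric]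
      ultraspherical_coeff_Suc_rec[OF assms] u_def[symmetric]
    by (simp add: smult_diff_left smult_add_left)
  moreover have "smult (?c (n + 2) 0) 1 = smult (?c (n + 1) 0) 1 - smult u (smult (?c n 0) (1 :: real poly))"
    unfolding ultraspherical_coeff_0_rec[OF assms] u_def[symmetric] by (simp add: smult_diff_left)
  ultimately show ?thesis
    unfolding u_def[symmetric] by (simp add: exp smult_add_right algebra_simps del: One_nat_def)
qed

lemma ultraspherical_monic_0: "ultraspherical_monic l 0 = 1"
  by (simp add: ultraspherical_monic_def)

lemma ultraspherical_monic_1:
  assumes "l > 0" shows "ultraspherical_monic l 1 = [:0, 1:]"
proof -
  have "1 + 2 * l \<noteq> 0" using assms by simp
  with assms show ?thesis
    by (simp add: ultraspherical_monic_def field_simps one_pCons)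
qed

text \<open>
  Differentiating \<open>z ^ Suc k\<close> cancels one factor of the factorial, and the leading factor of each
  Pochhammer symbol splits off. The remaining symbols start at \<open>-n\<close>, \<open>n + 2 (l + 1)\<close> and
  \<open>l + 1 + 1/2\<close>, which are the parameters belonging to \<open>n\<close> and \<open>l + 1\<close>.
\<close>
lemma pderiv_ultraspherical_monic:
  assumes "l > 0"
  shows "pderiv (ultraspherical_monic l (n + 1)) = smult (real n + 1) (ultraspherical_monic (l + 1) n)"
proof -
  define z :: "real poly" where "z = [:1/2, -1/2:]"
  have dz: "pderiv (z ^ k) = smult (- real k / 2) (z ^ (k - 1))" for k
    by (simp add: pderiv_power z_def pderiv_pCons)
  have coeff: "ultraspherical_coeff l (n + 1) (Suc k) * (- real (Suc k) / 2) =
      (real n + 1) * ultraspherical_coeff (l + 1) n k" for k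
  proof -
    have pos: "pochhammer (l + 1) n > 0" "pochhammer (l + 3/2) k > 0"
      using assms by (auto intro: pochhammer_pos)
    have 1: "pochhammer (2 * l) (n + 1) * (real n + 1 + 2 * l) =
        2 * l * (2 * l + 1) * pochhammer (2 * l + 2) n"
      using pochhammer_rec[of "2*l" "Suc n"] pochhammer_rec[of "2 * l + 1" n]
         pochhammer_Suc[of "2 * l" "Suc n"] by (simp add: algebra_simps)
    have 2: "pochhammer l (n + 1) = l * pochhammer (l + 1) n"
      by (simp add: pochhammer_rec)
    have 3: "pochhammer (- real (n + 1)) (Suc k) = - (real n + 1) * pochhammer (- real n) k"
      using pochhammer_rec[of "- real (n + 1)" k] by (simp add: algebra_simps)
    have 4: "pochhammer (real (n + 1) + 2 * l) (Suc k) =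
        (real n + 1 + 2 * l) * pochhammer (real n + 2 * (l + 1)) k"
      using pochhammer_rec[of "real (n + 1) + 2 * l" k] by (simp add: algebra_simps)
    have 5: "pochhammer (l + 1/2) (Suc k) = (l + 1/2) * pochhammer (l + 1 + 1/2) k"
      using pochhammer_rec[of "l + 1/2" k] by (simp add: algebra_simps)
    have "ultraspherical_coeff l (n + 1) (Suc k) * (- real (Suc k) / 2) =
      (pochhammer (2 * l) (n + 1) * (real n + 1 + 2 * l)) / (2 ^ (n + 1) * (l * pochhammer (l + 1) n)) *
       (- (real n + 1) * pochhammer (- real n) k * pochhammer (real n + 2 * (l + 1)) k /
       ((l + 1/2) * pochhammer (l + 1 + 1/2) k * (real (Suc k) * fact k))) * (- real (Suc k) / 2)"
      unfolding ultraspherical_coeff_def 2 3 4 5 fact_Suc by (simp add: mult_ac)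
    also have "\<dots> = (real n + 1) * ultraspherical_coeff (l + 1) n k"
      unfolding 1 ultraspherical_coeff_def using pos assms
      by (simp add: divide_simps) (simp add: algebra_simps)
    finally show ?thesis .
  qed
  have "pderiv (ultraspherical_monic l (n + 1)) =
      (\<Sum>k\<le>Suc n. smult (ultraspherical_coeff l (n + 1) k) (pderiv (z ^ k)))"
    by (simp add: ultraspherical_monic_altdef[OF order_refl] z_def pderiv_smult
         higher_pderiv_sum[of 1, simplified] del: sum.atMost_Suc)
  also have "\<dots> = (\<Sum>k\<le>n. smult (ultraspherical_coeff l (n + 1) (Suc k) * (- real (Suc k) / 2)) (z ^ k))"
    unfolding dz by (subst sum.atMost_Suc_shift) simp
  also have "\<dots> = smult (real n + 1) (ultraspherical_monic (l + 1) n)"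
    unfolding coeff by (simp add: ultraspherical_monic_altdef[OF order_refl] z_def smult_sum2)
  finally show ?thesis .
qed


lemma monic_three_term:
  fixes P :: "nat \<Rightarrow> 'a :: idom poly"
  assumes "P 0 = 1" "P 1 = [:0, 1:]"
    and "\<And>n. P (n + 2) = [:0, 1:] * P (n + 1) - smult (u n) (P n)"
  shows "degree (P n) = n \<and> lead_coeff (P n) = 1"
proof (induction n rule: induct_nat_012)
  case (ge2 n)
  then have "P (Suc n) \<noteq> 0" by auto
  then have "degree (pCons 0 (P (Suc n))) = n + 2" using ge2 by simp
  moreover have "degree (smult (u n) (P n)) < n + 2"
    using ge2 degree_smult_le[of "u n" "P n"] by simp
  ultimately show ?case
    using assms(3)[of n] ge2
     degree_add_eq_left[of "- smult (u n) (P n)" "pCons 0 (P (Suc n))"]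
     coeff_eq_0[of "P n" "n + 2"]
    by auto
qed (use assms in auto)

lemma ultraspherical_monic_monic:
  assumes "l > 0"
  shows "degree (ultraspherical_monic l n) = n" "lead_coeff (ultraspherical_monic l n) = 1"
proof -
  have "degree (ultraspherical_monic l n) = n \<and> lead_coeff (ultraspherical_monic l n) = 1"
    by (rule monic_three_term[OF ultraspherical_monic_0 ultraspherical_monic_1[OF assms]
          ultraspherical_monic_rec[OF assms]])
  then show "degree (ultraspherical_monic l n) = n" "lead_coeff (ultraspherical_monic l n) = 1"
    by blast+
qed

section \<open>Chebyshev polynomials of the second kind\<close>

lemma ultraspherical_monic_1_rec:
  "ultraspherical_monic 1 (n + 2) =
     [:0, 1:] * ultraspherical_monic 1 (n + 1) - smult (1/4) (ultraspherical_monic 1 n)"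
proof -
  have "real (n + 1) * (real n + 2 * 1) / (4 * (real n + 1 + 1) * (real n + 1)) = 1 / 4"
    by (simp add: divide_simps) (auto simp: algebra_simps)
  then show ?thesis using ultraspherical_monic_rec[of 1 n] by (simp only:)
qed

text \<open>
  Both sides satisfy the same recurrence: on the trigonometric side it is
  \<open>sin (a + \<theta>) + sin (a - \<theta>) = 2 cos \<theta> sin a\<close>.
\<close>
lemma chebyshev_U_monic_eq_ultraspherical: "chebyshev_U_monic n = ultraspherical_monic 1 n"
proof -
  have "poly (ultraspherical_monic 1 n) (cos \<theta>) = sin ((real n + 1) * \<theta>) / (2 ^ n * sin \<theta>)"
    if nz: "sin \<theta> \<noteq> 0" for \<theta>
  proof (induction n rule: induct_nat_012)
    case 0
    then show ?case using nz by (simp add: ultraspherical_monic_0)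
  next
    case 1
    then show ?case using nz ultraspherical_monic_1[of 1] by (simp add: sin_double)
  next
    case (ge2 n)
    define a where "a = (real (Suc n) + 1) * \<theta>"
    have e: "(real (Suc (Suc n)) + 1) * \<theta> = a + \<theta>" "(real n + 1) * \<theta> = a - \<theta>"
      by (simp_all add: a_def algebra_simps)
    have "sin (a + \<theta>) = 2 * cos \<theta> * sin a - sin (a - \<theta>)"
      by (simp add: sin_add sin_diff)
    moreover have "ultraspherical_monic 1 (Suc (Suc n)) =
        [:0, 1:] * ultraspherical_monic 1 (Suc n) - smult (1/4) (ultraspherical_monic 1 n)"
      using ultraspherical_monic_1_rec[of n] by simp
    ultimately show ?case
      using ge2 nz unfolding e a_def[symmetric] by (simp del: mult_pCons_left) (simp add: field_simps)
  qed
  then show ?thesis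
    unfolding chebyshev_U_monic_def
    by (intro the1_equality[OF ex1_chebyshev_U_monic]) blast
qed

text \<open>
  The product rule, applied to \<open>U\<^sub>n\<^sub>+\<^sub>3 = x U\<^sub>n\<^sub>+\<^sub>2 - U\<^sub>n\<^sub>+\<^sub>1 / 4\<close>, leaves \<open>U\<^sub>n\<^sub>+\<^sub>2\<close> without a
  derivative; the other terms are multiples of \<open>C\<^sub>n\<^sub>+\<^sub>2\<^sup>2\<close>, \<open>x C\<^sub>n\<^sub>+\<^sub>1\<^sup>2\<close> and \<open>C\<^sub>n\<^sup>2\<close>, and the recurrence
  for \<open>C\<^sup>2\<close> removes the first of them.
\<close>
lemma chebyshev_U_monic_connection:
  "chebyshev_U_monic (n + 2) = [:0, 1:] * ultraspherical_monic 2 (n + 1) -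
     smult (real (n + 1) / (2 * (real (n + 1) + 1))) (ultraspherical_monic 2 n)"
proof -
  let ?C = "ultraspherical_monic 2" and ?U = "ultraspherical_monic 1"
  have dU: "pderiv (?U (m + 1)) = smult (real m + 1) (?C m)" for m
    using pderiv_ultraspherical_monic[of 1 m] by simp
  define c where "c = real (n + 1) * (real n + 4) / (4 * (real n + 3) * (real n + 2))"
  have U: "?U (n + 3) = [:0, 1:] * ?U (n + 2) - smult (1/4) (?U (n + 1))"
    using ultraspherical_monic_1_rec[of "n + 1"] by (simp add: numeral_eq_Suc)
  have C: "?C (n + 2) = [:0, 1:] * ?C (n + 1) - smult c (?C n)"
    using ultraspherical_monic_rec[of 2 n] by (simp add: c_def add_ac)
  have "smult (real n + 3) (?C (n + 2)) = ?U (n + 2) + smult (real n + 2) ([:0, 1:] * ?C (n + 1))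
     - smult ((real n + 1) / 4) (?C n)"
    using arg_cong[OF U, of pderiv] dU[of "n + 2"] dU[of "n + 1"] dU[of n]
    by (simp add: pderiv_diff pderiv_smult pderiv_pCons numeral_eq_Suc add_ac)
  then have "?U (n + 2) = smult (real n + 3) ([:0, 1:] * ?C (n + 1) - smult c (?C n))
      - smult (real n + 2) ([:0, 1:] * ?C (n + 1)) + smult ((real n + 1) / 4) (?C n)"
    unfolding C by simp
  also have "\<dots> = [:0, 1:] * ?C (n + 1) - smult ((real n + 3) * c - (real n + 1) / 4) (?C n)"
    by (rule poly_eqI) (simp add: algebra_simps del: mult_pCons_left)
  also have "(real n + 3) * c - (real n + 1) / 4 = real (n + 1) / (2 * (real (n + 1) + 1))"
    by (simp add: c_def divide_simps) (simp add: algebra_simps)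
  finally show ?thesis by (simp add: chebyshev_U_monic_eq_ultraspherical)
qed

section \<open>The trigonometric grid\<close>

lemma trig_grid_angle_bounds:
  assumes "s \<le> N"
  shows "0 < pi * (real s + 1) / (real N + 2)" "pi * (real s + 1) / (real N + 2) < pi"
proof -
  have "(real s + 1) / (real N + 2) < 1" using assms by simp
  then have "pi * ((real s + 1) / (real N + 2)) < pi * 1" by (intro mult_strict_left_mono) auto
  then show "pi * (real s + 1) / (real N + 2) < pi" by simp
  show "0 < pi * (real s + 1) / (real N + 2)" by (intro divide_pos_pos mult_pos_pos) auto
qed

lemma inj_on_trig_grid: "inj_on (trig_grid N) {0..N}"
proof (rule inj_onI)
  fix s t assume st: "s \<in> {0..N}" "t \<in> {0..N}" "trig_grid N s = trig_grid N t"
  then have "s \<le> N" "t \<le> N" by simp_all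
  note bounds = this[THEN trig_grid_angle_bounds(1)] this[THEN trig_grid_angle_bounds(2)]
  have "cos (pi * (real s + 1) / (real N + 2)) = cos (pi * (real t + 1) / (real N + 2))"
    using st(3) unfolding trig_grid_def by (rule neg_equal_iff_equal[THEN iffD1])
  then have "pi * (real s + 1) / (real N + 2) = pi * (real t + 1) / (real N + 2)"
    using cos_inj_pi bounds[THEN less_imp_le] by blast
  then have "pi * (real s + 1) = pi * (real t + 1)"
    by (subst (asm) divide_cancel_right) simp
  then show "s = t" by simp
qed

lemma poly_chebyshev_U_monic_trig_grid:
  assumes "s \<le> N"
  shows "poly (chebyshev_U_monic (N + 1)) (trig_grid N s) = 0"
proof -
  define \<phi> where "\<phi> = pi * (real s + 1) / (real N + 2)"
  \<comment> \<open>The sign in front of the cosine is a shift of the angle by \<open>pi\<close>.\<close>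
  have "(real (N + 1) + 1) * (\<phi> + pi) = real (N + s + 3) * pi"
    by (simp add: \<phi>_def divide_simps) (simp add: algebra_simps)
  then have "sin ((real (N + 1) + 1) * (\<phi> + pi)) = 0" by (metis sin_npi)
  moreover have "sin (\<phi> + pi) \<noteq> 0"
    using sin_gt_zero[of \<phi>] trig_grid_angle_bounds[OF assms] by (simp add: \<phi>_def)
  moreover have "trig_grid N s = cos (\<phi> + pi)" by (simp add: trig_grid_def \<phi>_def)
  ultimately show ?thesis by (simp only: poly_chebyshev_U_monic simp_thms div_0)
qed

lemma chebyshev_U_monic_eq_prod:
  "chebyshev_U_monic (N + 1) = (\<Prod>s\<in>{0..N}. [:- trig_grid N s, 1:])"
proof (rule poly_eqI_degree_lead_coeff)
  let ?R = "\<Prod>s\<in>{0..N}. [:- trig_grid N s, 1:]"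
  have deg: "degree ?R = N + 1" by (subst degree_prod_eq_sum_degree) auto
  have lc: "lead_coeff ?R = 1" by (subst lead_coeff_prod) simp
  note U = ultraspherical_monic_monic[of 1 "N + 1", folded chebyshev_U_monic_eq_ultraspherical]
  show "coeff (chebyshev_U_monic (N + 1)) (N + 1) = coeff ?R (N + 1)"
    using U deg lc by simp
  show "degree (chebyshev_U_monic (N + 1)) \<le> N + 1" "degree ?R \<le> N + 1"
    using U deg by simp_all
  show "card (trig_grid N ` {0..N}) \<ge> N + 1"
    by (simp add: card_image inj_on_trig_grid)
  show "poly (chebyshev_U_monic (N + 1)) x = poly ?R x" if "x \<in> trig_grid N ` {0..N}" for x
    using that poly_chebyshev_U_monic_trig_grid by (force simp: poly_prod)
qed

section \<open>Uniqueness of Sturmian sequences\<close>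

text \<open>
  If two sequences agree at \<open>n + 1\<close> and \<open>n\<close>, subtracting their recurrences leaves
  \<open>(c\<^sub>n - b\<^sub>n) P\<^sub>n\<close> equal to a polynomial of degree below \<open>n\<close>; hence \<open>c\<^sub>n = b\<^sub>n\<close>. Then
  \<open>u\<^sub>n P\<^sub>n\<^sub>-\<^sub>1 = v\<^sub>n Q\<^sub>n\<^sub>-\<^sub>1\<close>, and since both polynomials are monic and \<open>u\<^sub>n\<close> is positive, they agree.
\<close>
lemma sturmian_sequence_unique:
  assumes P: "sturmian_sequence N x P b u" and Q: "sturmian_sequence N x Q c v"
  shows "n \<le> N + 1 \<Longrightarrow> Q n = P n" "n \<le> N \<Longrightarrow> c n = b n" "1 \<le> n \<Longrightarrow> n \<le> N \<Longrightarrow> v n = u n"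
proof -
  note defs = P[unfolded sturmian_sequence_def] Q[unfolded sturmian_sequence_def]
  have step: "Q (n - 1) = P (n - 1) \<and> c n = b n \<and> v n = u n"
    if n: "1 \<le> n" "n \<le> N" and eq: "Q (n + 1) = P (n + 1)" "Q n = P n" for n
  proof -
    have mono: "degree (P m) = m" "lead_coeff (P m) = 1" "degree (Q m) = m" "lead_coeff (Q m) = 1"
      if "m \<le> N + 1" for m
    proof -
      have "m \<in> {0..N + 1}" using that by simp
      with defs show "degree (P m) = m" "lead_coeff (P m) = 1" "degree (Q m) = m" "lead_coeff (Q m) = 1"
        by blast+
    qed
    have P_rec: "P (n + 1) = [:- b n, 1:] * P n - smult (u n) (P (n - 1))" and "u n > 0"
      and Q_rec: "Q (n + 1) = [:- c n, 1:] * Q n - smult (v n) (Q (n - 1))"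
      using defs n by auto
    have diff: "smult (c n - b n) (P n) = smult (u n) (P (n - 1)) - smult (v n) (Q (n - 1))"
      using P_rec Q_rec unfolding eq
      by (simp add: smult_diff_left algebra_simps)
    have "coeff (P (n - 1)) n = 0" "coeff (Q (n - 1)) n = 0" "coeff (P n) n = 1"
      using mono[of "n - 1"] mono[of n] n by (auto intro!: coeff_eq_0)
    with arg_cong[OF diff, of "\<lambda>p. coeff p n"] have bc: "c n = b n" by simp
    with diff have uv: "smult (u n) (P (n - 1)) = smult (v n) (Q (n - 1))" by simp
    moreover have "coeff (P (n - 1)) (n - 1) = 1" "coeff (Q (n - 1)) (n - 1) = 1"
      using mono[of "n - 1"] n by auto
    ultimately have "u n = v n" by (metis coeff_smult mult.right_neutral)
    with uv \<open>u n > 0\<close> bc show ?thesis by (metis less_irrefl smult_cancel)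
  qed
  \<comment> \<open>Two consecutive members determine the next lower one, so the induction carries pairs.\<close>
  have PQ: "Q (N + 1 - k) = P (N + 1 - k) \<and> Q (N - k) = P (N - k)" if "k \<le> N" for k
    using that
  proof (induction k)
    case 0
    then show ?case using defs by simp
  next
    case (Suc k)
    then show ?case using step[of "N - k"] by (auto simp: Suc_diff_le)
  qed
  show eq: "Q n = P n" if "n \<le> N + 1" for n
  proof (cases "n = N + 1")
    case True
    then show ?thesis using PQ[of 0] by simp
  next
    case False
    then show ?thesis using PQ[of "N - n"] that by simp
  qed
  show "v n = u n" if "1 \<le> n" "n \<le> N"
    using step[OF that] eq that by simp
  show "c n = b n" if "n \<le> N"
  proof (cases "n = 0")
    case True
    then show ?thesis using defs eq[of 1] by simp
  next
    case False
    then show ?thesis using step[of n] eq that by simp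
  qed
qed

section \<open>The Sturmian sequence on the trigonometric grid\<close>

theorem mainTheorem8:
  fixes N :: nat and P :: "nat \<Rightarrow> real poly" and u :: "nat \<Rightarrow> real"
  assumes "N \<ge> 1"
    and "P (N + 1) = chebyshev_U_monic (N + 1)"
    and "\<forall>n\<in>{0..N}. P n = ultraspherical_monic 2 n"
    and "\<forall>n\<in>{1..N - 1}. u n = real n * (real n + 3) / (4 * (real n + 2) * (real n + 1))"
    and "u N = real N / (2 * (real N + 1))"
  shows "{x. poly (chebyshev_U_monic (N + 1)) x = 0} = trig_grid N ` {0..N} \<and>
         sturmian_sequence N (trig_grid N) P (\<lambda>n. 0) u \<and>
         (\<forall>Q b v. sturmian_sequence N (trig_grid N) Q b v \<longrightarrow>
            (\<forall>n\<in>{0..N + 1}. Q n = P n) \<and>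
            (\<forall>n\<in>{0..N}. b n = 0) \<and>
            (\<forall>n\<in>{1..N}. v n = u n)) \<and>
         (\<forall>n\<in>{1..N}. P (n + 1) + smult (u n) (P (n - 1)) = [:0, 1:] * P n)"
proof -
  have rec: "P (n + 1) = [:0, 1:] * P n - smult (u n) (P (n - 1))" if n: "n \<in> {1..N}" for n
  proof -
    from n obtain m where m: "n = Suc m" by (cases n) auto
    show ?thesis
    proof (cases "n = N")
      case True
      then have "N = Suc m" using m by simp
      then show ?thesis using assms(2,3,5) m chebyshev_U_monic_connection[of m]
        by (simp add: add_ac)
    next
      case False
      then have "u n = real (m + 1) * (real m + 2 * 2) / (4 * (real m + 1 + 2) * (real m + 2))"
        using assms(4) n m by (simp add: add_ac)
      then show ?thesis using assms(3) n m False ultraspherical_monic_rec[of 2 m] by simp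
    qed
  qed
  have u_pos: "u n > 0" if "n \<in> {1..N}" for n
    using assms(4,5) that by (cases "n = N") auto
  have monic: "degree (P n) = n \<and> lead_coeff (P n) = 1" if "n \<in> {0..N + 1}" for n
    using that assms(2,3) ultraspherical_monic_monic[of 1 "N + 1"] ultraspherical_monic_monic[of 2 n]
    by (cases "n = N + 1") (auto simp: chebyshev_U_monic_eq_ultraspherical)
  have "P N = smult (1 / (real N + 1)) (pderiv (P (N + 1)))"
    using assms(2,3) pderiv_ultraspherical_monic[of 1 N]
    by (simp add: chebyshev_U_monic_eq_ultraspherical add_eq_0_iff)
  moreover have "P 1 = [:- 0, 1:]"
    using assms(1,3) ultraspherical_monic_1[of 2] by simp
  ultimately have sturm: "sturmian_sequence N (trig_grid N) P (\<lambda>n. 0) u"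
    unfolding sturmian_sequence_def
    using inj_on_trig_grid[of N] assms(2) chebyshev_U_monic_eq_prod[of N] monic u_pos rec
    by (intro conjI ballI monic[THEN conjunct1] monic[THEN conjunct2] u_pos) auto
  moreover have "{x. poly (chebyshev_U_monic (N + 1)) x = 0} = trig_grid N ` {0..N}"
    unfolding chebyshev_U_monic_eq_prod by (auto simp: poly_prod)
  moreover have "\<forall>Q b v. sturmian_sequence N (trig_grid N) Q b v \<longrightarrow>
      (\<forall>n\<in>{0..N + 1}. Q n = P n) \<and> (\<forall>n\<in>{0..N}. b n = 0) \<and> (\<forall>n\<in>{1..N}. v n = u n)"
    using sturmian_sequence_unique[OF sturm] by fastforce
  moreover have "\<forall>n\<in>{1..N}. P (n + 1) + smult (u n) (P (n - 1)) = [:0, 1:] * P n"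
    using rec by simp
  ultimately show ?thesis by blast
qed

end
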